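(* Let $m,n\ge 3$ be integers. The number of spanning trees of the graph $K_m\times C_n$ is $$\frac{n}{m}\left(\left(\frac{m+2+\sqrt{m^2+4m}}{2}\right)^n+\left(\frac{m+2-\sqrt{m^2+4m}}{2}\right)^n-2\right)^{m-1}.$$
   Context: $K_m$ is the complete graph on $m$ vertices and $C_n$ is the cycle on $n$ vertices. The Cartesian product $G_1\times G_2$ of graphs $G_1=(V_1,E_1)$, $G_2=(V_2,E_2)$ has vertex set $V_1\times V_2$, and $(u_1,v_1)$ is adjacent to $(u_2,v_2)$ if and only if either $u_1=u_2$ and $(v_1,v_2)\in E_2$, or $(u_1,u_2)\in E_1$ and $v_1=v_2$. *)

theory Defs
  imports Complex_Main
begin

text \<open>
  Finite simple undirected graphs as pairs $(V, E)$, where every edge is a two-element subset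
  of $V$.  The AFP entry Graph\_Theory is not used: its notion of a (spanning) tree only excludes
  directed cycles, so on symmetric digraphs it does not count undirected spanning trees.
\<close>

type_synonym 'a ugraph = "'a set \<times> 'a set set"

abbreviation uverts :: "'a ugraph \<Rightarrow> 'a set" where
  "uverts G \<equiv> fst G"

abbreviation uedges :: "'a ugraph \<Rightarrow> 'a set set" where
  "uedges G \<equiv> snd G"

definition simple_ugraph :: "'a ugraph \<Rightarrow> bool" where
  "simple_ugraph G \<longleftrightarrow> finite (uverts G) \<and>
     (\<forall>e\<in>uedges G. \<exists>u v. e = {u, v} \<and> u \<noteq> v \<and> u \<in> uverts G \<and> v \<in> uverts G)"

definition uadj :: "'a ugraph \<Rightarrow> 'a \<Rightarrow> 'a \<Rightarrow> bool" where
  "uadj G u v \<longleftrightarrow> {u, v} \<in> uedges G"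

definition uwalk :: "'a ugraph \<Rightarrow> 'a list \<Rightarrow> bool" where
  "uwalk G xs \<longleftrightarrow> xs \<noteq> [] \<and> set xs \<subseteq> uverts G \<and> successively (uadj G) xs"

definition uconnected :: "'a ugraph \<Rightarrow> bool" where
  "uconnected G \<longleftrightarrow> uverts G \<noteq> {} \<and>
     (\<forall>u\<in>uverts G. \<forall>v\<in>uverts G. \<exists>xs. uwalk G xs \<and> hd xs = u \<and> last xs = v)"

text \<open>
  A cycle is given by the list of its distinct vertices; the closing edge joins the last
  vertex to the first.  At least three vertices are required, so that traversing an edge back
  and forth is not a cycle.
\<close>

definition ucycle :: "'a ugraph \<Rightarrow> 'a list \<Rightarrow> bool" where
  "ucycle G xs \<longleftrightarrow> length xs \<ge> 3 \<and> distinct xs \<and> uwalk G xs \<and> uadj G (last xs) (hd xs)"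

definition utree :: "'a ugraph \<Rightarrow> bool" where
  "utree G \<longleftrightarrow> simple_ugraph G \<and> uconnected G \<and> (\<nexists>xs. ucycle G xs)"

definition spanning_utrees :: "'a ugraph \<Rightarrow> 'a ugraph set" where
  "spanning_utrees G = {T. utree T \<and> uverts T = uverts G \<and> uedges T \<subseteq> uedges G}"

definition complete_ugraph :: "nat \<Rightarrow> nat ugraph" where
  "complete_ugraph m = ({0..<m}, {{u, v} | u v. u < m \<and> v < m \<and> u \<noteq> v})"

text \<open>
  The following is the usual cycle only for $n \ge 3$; for $n = 1$ it has a degenerate
  singleton edge, and for $n = 2$ it is a single edge.
\<close>

definition cycle_ugraph :: "nat \<Rightarrow> nat ugraph" where
  "cycle_ugraph n = ({0..<n}, {{i, (i + 1) mod n} | i. i < n})"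

definition cartesian_ugraph :: "'a ugraph \<Rightarrow> 'b ugraph \<Rightarrow> ('a \<times> 'b) ugraph" where
  "cartesian_ugraph G1 G2 = (uverts G1 \<times> uverts G2,
     {{(u1, v1), (u2, v2)} | u1 v1 u2 v2.
        (u1, v1) \<in> uverts G1 \<times> uverts G2 \<and> (u2, v2) \<in> uverts G1 \<times> uverts G2 \<and>
        (u1 = u2 \<and> {v1, v2} \<in> uedges G2 \<or> {u1, u2} \<in> uedges G1 \<and> v1 = v2)})"

lemma simple_complete_ugraph: "simple_ugraph (complete_ugraph m)"
  unfolding simple_ugraph_def complete_ugraph_def by auto

lemma simple_cycle_ugraph:
  assumes "n \<ge> 3"
  shows "simple_ugraph (cycle_ugraph n)"
proof -
  have "\<exists>u v. {i, (i + 1) mod n} = {u, v} \<and> u \<noteq> v \<and> u < n \<and> v < n" if "i < n" for i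
  proof -
    have "(i + 1) mod n \<noteq> i"
      using that assms by (cases "i + 1 = n") auto
    moreover have "(i + 1) mod n < n"
      using assms by simp
    ultimately show ?thesis
      using that by metis
  qed
  then show ?thesis
    unfolding simple_ugraph_def cycle_ugraph_def by auto
qed

lemma uadj_cartesian_ugraph:
  "uadj (cartesian_ugraph G1 G2) (u1, v1) (u2, v2) \<longleftrightarrow>
     u1 \<in> uverts G1 \<and> v1 \<in> uverts G2 \<and> u2 \<in> uverts G1 \<and> v2 \<in> uverts G2 \<and>
     (u1 = u2 \<and> uadj G2 v1 v2 \<or> uadj G1 u1 u2 \<and> v1 = v2)"
  unfolding uadj_def cartesian_ugraph_def
  by (auto simp: doubleton_eq_iff insert_commute)

lemma simple_cartesian_ugraph:
  assumes "simple_ugraph G1" "simple_ugraph G2"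
  shows "simple_ugraph (cartesian_ugraph G1 G2)"
proof -
  have ne1: "u \<noteq> v" if "{u, v} \<in> uedges G1" for u v
    using assms(1) that unfolding simple_ugraph_def by (metis doubleton_eq_iff)
  have ne2: "u \<noteq> v" if "{u, v} \<in> uedges G2" for u v
    using assms(2) that unfolding simple_ugraph_def by (metis doubleton_eq_iff)
  have "\<exists>x y. e = {x, y} \<and> x \<noteq> y \<and> x \<in> uverts G1 \<times> uverts G2 \<and> y \<in> uverts G1 \<times> uverts G2"
    if e: "e \<in> uedges (cartesian_ugraph G1 G2)" for e
  proof -
    from e obtain u1 v1 u2 v2 where "e = {(u1, v1), (u2, v2)}"
      and "(u1, v1) \<in> uverts G1 \<times> uverts G2" "(u2, v2) \<in> uverts G1 \<times> uverts G2"
      and "u1 = u2 \<and> {v1, v2} \<in> uedges G2 \<or> {u1, u2} \<in> uedges G1 \<and> v1 = v2"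
      unfolding cartesian_ugraph_def by auto
    moreover from this have "(u1, v1) \<noteq> (u2, v2)"
      using ne1 ne2 by blast
    ultimately show ?thesis
      by blast
  qed
  moreover have "finite (uverts (cartesian_ugraph G1 G2))"
    using assms by (simp add: simple_ugraph_def cartesian_ugraph_def)
  ultimately show ?thesis
    unfolding simple_ugraph_def by (simp add: cartesian_ugraph_def)
qed

end

theory Submission
  imports Defs "Jordan_Normal_Form.Determinant" "HOL-Library.FuncSet"
    "HOL-Computational_Algebra.Fundamental_Theorem_Algebra"
begin

text \<open>
  The proof combines the matrix-tree theorem with the spectrum of the Laplacian \<open>L\<close> of the
  product graph.

  Multilinearity in the rows expands \<open>det (x I + L)\<close> into a sum over maps that send every vertex
  to a neighbour or to a root marker.  A map whose iteration runs into a cycle contributes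
  nothing; any other map is a rooted spanning forest and contributes \<open>x\<close> to the power of its
  number of roots (\<open>det_Laplacian_eq_sum_parent_maps\<close>).  The forests with one root are the
  spanning trees with a distinguished vertex (\<open>card_parent_maps_one_root\<close>).  So the number of
  spanning trees times the number of vertices is the coefficient of \<open>x\<close> (\<open>matrix_tree\<close>).

  For the product of the complete graph on \<open>m\<close> and the cycle on \<open>n\<close> vertices, the characters
  of \<open>Z_m \<times> Z_n\<close> diagonalize \<open>L\<close>, its eigenvalues being the sums of eigenvalues of the two factors.
  With \<open>Q y\<close> denoting the product of \<open>y + 2 - w - 1 / w\<close> over the \<open>n\<close>-th roots of unity \<open>w\<close>, this gives
  \<open>det (x I + L) = Q x * Q (x + m) ^ (m - 1)\<close> (\<open>det_Laplacian_prism\<close>).  The factor \<open>Q x\<close> has a simple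
  zero at 0, and dividing it by \<open>x\<close> leaves the value \<open>n\<^sup>2\<close> there (\<open>cycle_poly_red_0\<close>), while
  \<open>Q m = \<alpha> ^ n + \<beta> ^ n - 2\<close> for the numbers with \<open>\<alpha> * \<beta> = 1\<close> and \<open>\<alpha> + \<beta> = m + 2\<close> (\<open>cycle_poly_eq\<close>).
  Dividing by the number \<open>m * n\<close> of vertices gives the formula.
\<close>

section \<open>Determinants over finite index sets\<close>

text \<open>
  The entries of a Laplacian are naturally indexed by vertices.  A matrix over a finite set
  \<open>V\<close> becomes an ordinary matrix by way of one fixed, arbitrary enumeration of \<open>V\<close>; since rows
  and columns are permuted alike, the determinant does not depend on that choice.
\<close>

definition enum_of :: "'a set \<Rightarrow> nat \<Rightarrow> 'a" where
  "enum_of V = (SOME e. bij_betw e {0..<card V} V)"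

definition mat_on :: "'a set \<Rightarrow> ('a \<Rightarrow> 'a \<Rightarrow> 'b) \<Rightarrow> 'b mat" where
  "mat_on V A = mat (card V) (card V) (\<lambda>(i, j). A (enum_of V i) (enum_of V j))"

definition det_on :: "'a set \<Rightarrow> ('a \<Rightarrow> 'a \<Rightarrow> 'b::comm_ring_1) \<Rightarrow> 'b" where
  "det_on V A = det (mat_on V A)"

lemma bij_enum: "finite V \<Longrightarrow> bij_betw (enum_of V) {0..<card V} V"
  unfolding enum_of_def using ex_bij_betw_nat_finite[of V] by (rule someI_ex)

lemma mat_on_carrier [simp]: "mat_on V A \<in> carrier_mat (card V) (card V)"
  unfolding mat_on_def by simp

lemma enum_mem: "finite V \<Longrightarrow> i < card V \<Longrightarrow> enum_of V i \<in> V"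
  using bij_enum[of V] by (auto simp: bij_betw_def)

lemma enum_eq_iff: "finite V \<Longrightarrow> i < card V \<Longrightarrow> j < card V \<Longrightarrow> enum_of V i = enum_of V j \<longleftrightarrow> i = j"
  using bij_enum[of V] by (auto simp: bij_betw_def inj_on_def)

lemma det_on_Leibniz:
  "det_on V A = (\<Sum>p | p permutes {0..<card V}.
      signof p * (\<Prod>i = 0..<card V. A (enum_of V i) (enum_of V (p i))))"
proof -
  have "det_on V A = (\<Sum>p | p permutes {0..<card V}.
      signof p * (\<Prod>i = 0..<card V. mat_on V A $$ (i, p i)))"
    unfolding det_on_def by (rule det_def') simp
  also have "\<dots> = (\<Sum>p | p permutes {0..<card V}.
      signof p * (\<Prod>i = 0..<card V. A (enum_of V i) (enum_of V (p i))))"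
  proof (rule sum.cong[OF refl])
    fix p assume "p \<in> {p. p permutes {0..<card V}}"
    then have "p i < card V" if "i < card V" for i
      using that permutes_in_image[of p "{0..<card V}" i] by simp
    then show "signof p * (\<Prod>i = 0..<card V. mat_on V A $$ (i, p i)) =
      signof p * (\<Prod>i = 0..<card V. A (enum_of V i) (enum_of V (p i)))"
      by (simp add: mat_on_def)
  qed
  finally show ?thesis .
qed

lemma det_on_cong:
  assumes "finite V" "\<And>u v. u \<in> V \<Longrightarrow> v \<in> V \<Longrightarrow> A u v = B u v"
  shows "det_on V A = det_on V B"
proof -
  have "mat_on V A = mat_on V B"
    unfolding mat_on_def using assms by (intro eq_matI) (auto simp: enum_mem)
  then show ?thesis by (simp add: det_on_def)
qed

lemma det_on_mult:
  assumes "finite V"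
  shows "det_on V (\<lambda>u v. \<Sum>w\<in>V. A u w * B w v) = det_on V A * det_on V B"
proof -
  have "mat_on V (\<lambda>u v. \<Sum>w\<in>V. A u w * B w v) = mat_on V A * mat_on V B"
  proof (rule eq_matI)
    fix i j assume "i < dim_row (mat_on V A * mat_on V B)" "j < dim_col (mat_on V A * mat_on V B)"
    then have ij: "i < card V" "j < card V" by (auto simp: mat_on_def)
    have "(\<Sum>w\<in>V. A (enum_of V i) w * B w (enum_of V j)) =
        (\<Sum>k = 0..<card V. A (enum_of V i) (enum_of V k) * B (enum_of V k) (enum_of V j))"
      by (rule sum.reindex_bij_betw[OF bij_enum[OF assms], symmetric])
    then show "mat_on V (\<lambda>u v. \<Sum>w\<in>V. A u w * B w v) $$ (i, j) = (mat_on V A * mat_on V B) $$ (i, j)"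
      using ij by (simp add: mat_on_def scalar_prod_def)
  qed (auto simp: mat_on_def)
  then show ?thesis
    unfolding det_on_def by (simp add: det_mult[OF mat_on_carrier mat_on_carrier])
qed

lemma det_on_eq_0:
  fixes A :: "'a \<Rightarrow> 'a \<Rightarrow> 'b::field"
  assumes "finite V" "w \<in> V" "x w \<noteq> 0"
    and ker: "\<And>u. u \<in> V \<Longrightarrow> (\<Sum>v\<in>V. A u v * x v) = 0"
  shows "det_on V A = 0"
proof -
  let ?x = "vec (card V) (\<lambda>i. x (enum_of V i))"
  obtain k where k: "k < card V" "enum_of V k = w"
    using bij_betw_imp_surj_on[OF bij_enum[OF assms(1)]] assms(2) by (metis atLeastLessThan_iff imageE)
  have "?x \<noteq> 0\<^sub>v (card V)"
  proof
    assume "?x = 0\<^sub>v (card V)"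
    then have "?x $ k = 0\<^sub>v (card V) $ k" by simp
    then show False using k assms(3) by simp
  qed
  moreover have "mat_on V A *\<^sub>v ?x = 0\<^sub>v (card V)"
  proof (rule eq_vecI)
    fix i assume "i < dim_vec (0\<^sub>v (card V) :: 'b vec)"
    then have i: "i < card V" by simp
    have "(\<Sum>k = 0..<card V. A (enum_of V i) (enum_of V k) * x (enum_of V k)) =
        (\<Sum>v\<in>V. A (enum_of V i) v * x v)"
      by (rule sum.reindex_bij_betw[OF bij_enum[OF assms(1)]])
    also have "\<dots> = 0" using ker i assms(1) by (simp add: enum_mem)
    finally show "(mat_on V A *\<^sub>v ?x) $ i = 0\<^sub>v (card V) $ i"
      using i by (simp add: mat_on_def scalar_prod_def)
  qed (simp add: mat_on_def)
  moreover have "?x \<in> carrier_vec (card V)" by simp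
  ultimately show ?thesis
    unfolding det_on_def using det_0_iff_vec_prod_zero_field[OF mat_on_carrier] by blast
qed

text \<open>
  Only the identity survives in the Leibniz formula.  This covers diagonal matrices, and also
  matrices that are triangular for some unspecified order of the index set.
\<close>

lemma det_on_prod_diag:
  fixes A :: "'a \<Rightarrow> 'a \<Rightarrow> 'b::idom"
  assumes fin: "finite V"
    and A: "\<And>p. p permutes {0..<card V} \<Longrightarrow> p \<noteq> id \<Longrightarrow>
      \<exists>i<card V. A (enum_of V i) (enum_of V (p i)) = 0"
  shows "det_on V A = (\<Prod>v\<in>V. A v v)"
proof -
  let ?P = "{p. p permutes {0..<card V}}"
  have "det_on V A = (\<Sum>p\<in>?P. if p = id then \<Prod>i = 0..<card V. A (enum_of V i) (enum_of V i) else 0)"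
    unfolding det_on_Leibniz
  proof (rule sum.cong[OF refl])
    fix p assume p: "p \<in> ?P"
    show "signof p * (\<Prod>i = 0..<card V. A (enum_of V i) (enum_of V (p i))) =
      (if p = id then \<Prod>i = 0..<card V. A (enum_of V i) (enum_of V i) else 0)"
    proof (cases "p = id")
      case False
      then have "(\<Prod>i = 0..<card V. A (enum_of V i) (enum_of V (p i))) = 0"
        using A[of p] p by (intro prod_zero) auto
      then show ?thesis using False by simp
    qed simp
  qed
  also have "\<dots> = (\<Prod>i = 0..<card V. A (enum_of V i) (enum_of V i))"
    by (simp add: finite_permutations permutes_id)
  also have "\<dots> = (\<Prod>v\<in>V. A v v)"
    by (rule prod.reindex_bij_betw[OF bij_enum[OF fin]])
  finally show ?thesis .
qed

lemma permutes_moved: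
  assumes "p permutes S" "p \<noteq> id"
  obtains i where "i \<in> S" "p i \<noteq> i"
  using assms by (auto simp: permutes_def fun_eq_iff)

lemma det_on_diag:
  fixes d :: "'a \<Rightarrow> 'b::idom"
  assumes fin: "finite V"
  shows "det_on V (\<lambda>u v. if u = v then d u else 0) = (\<Prod>v\<in>V. d v)"
proof -
  have "det_on V (\<lambda>u v. if u = v then d u else 0) = (\<Prod>v\<in>V. if v = v then d v else 0)"
  proof (rule det_on_prod_diag[OF fin])
    fix p assume p: "p permutes {0..<card V}" "p \<noteq> id"
    then obtain i where i: "i \<in> {0..<card V}" "p i \<noteq> i" by (rule permutes_moved)
    then have "p i < card V" using p permutes_in_image[of p "{0..<card V}" i] by simp
    then show "\<exists>i<card V. (if enum_of V i = enum_of V (p i) then d (enum_of V i) else 0) = 0"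
      using i fin by (intro exI[of _ i]) (auto simp: enum_eq_iff)
  qed
  then show ?thesis by simp
qed

text \<open>
  The columns of \<open>F\<close> are eigenvectors with eigenvalues \<open>d\<close>.  The matrix \<open>G\<close> is, up to the
  factor \<open>c\<close>, an inverse of \<open>F\<close>, so \<open>det F\<close> can be cancelled from \<open>det A * det F = det F * \<Prod> d\<close>.
\<close>

lemma det_on_diagonalize:
  fixes A F G :: "'a \<Rightarrow> 'a \<Rightarrow> 'b::field"
  assumes fin: "finite V" and c: "c \<noteq> 0"
    and eig: "\<And>u v. u \<in> V \<Longrightarrow> v \<in> V \<Longrightarrow> (\<Sum>w\<in>V. A u w * F w v) = F u v * d v"
    and inv: "\<And>u v. u \<in> V \<Longrightarrow> v \<in> V \<Longrightarrow> (\<Sum>w\<in>V. F u w * G w v) = (if u = v then c else 0)"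
  shows "det_on V A = (\<Prod>v\<in>V. d v)"
proof -
  have "det_on V F * det_on V G = det_on V (\<lambda>u v. if u = v then c else 0)"
    unfolding det_on_mult[OF fin, symmetric] using inv by (intro det_on_cong[OF fin])
  also have "\<dots> = (\<Prod>v\<in>V. c)" by (rule det_on_diag[OF fin])
  finally have F: "det_on V F \<noteq> 0" using c by auto
  have "det_on V A * det_on V F = det_on V (\<lambda>u v. \<Sum>w\<in>V. A u w * F w v)"
    by (rule det_on_mult[OF fin, symmetric])
  also have "\<dots> = det_on V (\<lambda>u v. \<Sum>w\<in>V. F u w * (if w = v then d w else 0))"
    using eig fin by (intro det_on_cong[OF fin]) (auto simp: if_distrib cong: if_cong)
  also have "\<dots> = det_on V F * (\<Prod>v\<in>V. d v)"
    by (simp add: det_on_mult[OF fin] det_on_diag[OF fin])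
  finally show ?thesis using F by simp
qed

section \<open>The Laplacian determinant as a sum over rooted forests\<close>

text \<open>
  A map \<open>f\<close> sends each vertex to its parent, or to \<open>None\<close> if the vertex is a root.  On a
  finite set closed under parents, a strictly decreasing rank exists exactly when iterating \<open>f\<close>
  from any vertex ends in a root, that is, when \<open>f\<close> is a rooted forest.  A rank is what both
  kinds of argument below consume: induction towards the root, and extremal vertices.
\<close>

definition ranked :: "'a set \<Rightarrow> ('a \<Rightarrow> 'a option) \<Rightarrow> bool" where
  "ranked V f \<longleftrightarrow> (\<exists>d :: 'a \<Rightarrow> nat. \<forall>v\<in>V. \<forall>u. f v = Some u \<longrightarrow> d u < d v)"

text \<open>
  Row \<open>u\<close> is the difference of the unit vectors of \<open>u\<close> and of its parent, where \<open>None\<close>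
  contributes the zero vector.
\<close>

definition step_mat :: "('a \<Rightarrow> 'a option) \<Rightarrow> 'a \<Rightarrow> 'a \<Rightarrow> 'b::comm_ring_1" where
  "step_mat f u v = of_bool (u = v) - of_bool (f u = Some v)"

text \<open>
  If a nontrivial permutation contributed to the Leibniz formula, it would have to send every
  point that it moves to its parent.  The moved points would then be closed under parents, which
  is impossible at a moved point of least rank.
\<close>

lemma det_step_mat_ranked:
  assumes fin: "finite V" and "ranked V f"
  shows "det_on V (step_mat f) = (1 :: 'b::idom)"
proof -
  obtain d :: "'a \<Rightarrow> nat" where d: "\<And>v u. v \<in> V \<Longrightarrow> f v = Some u \<Longrightarrow> d u < d v"
    using assms(2) unfolding ranked_def by blast
  have "det_on V (step_mat f) = (\<Prod>v\<in>V. step_mat f v v :: 'b)"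
  proof (rule det_on_prod_diag[OF fin])
    fix p assume p: "p permutes {0..<card V}" "p \<noteq> id"
    define D where "D = {i. i < card V \<and> p i \<noteq> i}"
    have "D \<noteq> {}" using permutes_moved[OF p] unfolding D_def by fastforce
    then obtain i where i: "i \<in> D" "\<And>j. j \<in> D \<Longrightarrow> d (enum_of V i) \<le> d (enum_of V j)"
      using ex_has_least_nat[of "\<lambda>i. i \<in> D" _ "\<lambda>i. d (enum_of V i)"] by blast
    have pi: "p i \<in> D"
      using i(1) p(1) permutes_in_image[of p "{0..<card V}" i] permutes_inj[OF p(1)]
      by (auto simp: D_def inj_def)
    then have "\<not> d (enum_of V (p i)) < d (enum_of V i)" using i(2) by (simp add: not_less)
    then have "f (enum_of V i) \<noteq> Some (enum_of V (p i))"
      using d i(1) fin by (auto simp: D_def enum_mem)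
    then have "step_mat f (enum_of V i) (enum_of V (p i)) = (0 :: 'b)"
      using i(1) pi fin by (auto simp: step_mat_def D_def enum_eq_iff)
    then show "\<exists>i<card V. step_mat f (enum_of V i) (enum_of V (p i)) = (0 :: 'b)"
      using i(1) by (auto simp: D_def)
  qed
  also have "\<dots> = (\<Prod>v\<in>V. 1)"
    using d by (intro prod.cong refl) (auto simp: step_mat_def)
  finally show ?thesis by simp
qed

text \<open>
  The indicator function of the vertices from which \<open>None\<close> is never reached is a kernel vector,
  because such a vertex and its parent have the same value.
\<close>

lemma det_step_mat_not_ranked:
  assumes fin: "finite V" and f: "\<And>v u. v \<in> V \<Longrightarrow> f v = Some u \<Longrightarrow> u \<in> V" and "\<not> ranked V f"
  shows "det_on V (step_mat f) = (0 :: 'b::field)"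
proof -
  \<comment> \<open>\<open>it k v\<close> is the \<open>k\<close>-th ancestor of \<open>v\<close>, or \<open>None\<close> once the path has left through a root.\<close>
  define it where "it k v = ((\<lambda>y. Option.bind y f) ^^ k) (Some v)" for k v
  have it_0: "it 0 v = Some v" for v by (simp add: it_def)
  have it_None: "((\<lambda>y. Option.bind y f) ^^ k) None = None" for k
    by (induction k) auto
  have it_Suc: "it (Suc k) v = (case f v of None \<Rightarrow> None | Some u \<Rightarrow> it k u)" for k v
    unfolding it_def funpow_Suc_right using it_None by (auto split: option.split)
  define U where "U = {v \<in> V. \<forall>k. it k v \<noteq> None}"
  have "U \<noteq> {}"
  proof
    assume U: "U = {}"
    \<comment> \<open>If every path leaves, the time needed for that is a rank.\<close>
    define d where "d v = (LEAST k. it k v = None)" for v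
    have "d u < d v" if v: "v \<in> V" "f v = Some u" for u v
    proof -
      have "\<exists>k. it k v = None" using U v by (auto simp: U_def)
      then have *: "it (d v) v = None" unfolding d_def by (rule LeastI_ex)
      then obtain k where k: "d v = Suc k" by (cases "d v") (auto simp: it_0)
      with * v have "it k u = None" by (simp add: it_Suc)
      then have "d u \<le> k" unfolding d_def by (rule Least_le)
      then show ?thesis using k by simp
    qed
    then have "ranked V f" unfolding ranked_def by blast
    then show False using assms(3) by simp
  qed
  then obtain w where w: "w \<in> U" by blast
  have closed: "u \<in> U \<longleftrightarrow> v \<in> U" if "v \<in> V" "f v = Some u" for u v
  proof -
    have "(\<forall>k. it k v \<noteq> None) \<longleftrightarrow> (\<forall>k. it (Suc k) v \<noteq> None)"
      using it_0 by (metis not0_implies_Suc option.distinct(1))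
    then show ?thesis using that f by (auto simp: U_def it_Suc)
  qed
  have root: "v \<notin> U" if "f v = None" for v
    using it_Suc[of 0 v] that by (auto simp: U_def)
  show ?thesis
  proof (rule det_on_eq_0[OF fin, of w "\<lambda>v. of_bool (v \<in> U)"])
    show "w \<in> V" "of_bool (w \<in> U) \<noteq> (0::'b)" using w by (auto simp: U_def)
    fix u assume u: "u \<in> V"
    have "(\<Sum>v\<in>V. step_mat f u v * of_bool (v \<in> U)) =
      (\<Sum>v\<in>V. if v = u then of_bool (v \<in> U) else 0) -
      (\<Sum>v\<in>V. if Some v = f u then of_bool (v \<in> U) else (0::'b))"
      unfolding sum_subtractf[symmetric]
      by (intro sum.cong refl) (auto simp: step_mat_def algebra_simps)
    also have "\<dots> = 0"
    proof (cases "f u")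
      case None
      then show ?thesis using u fin root[of u] by (simp add: sum.delta')
    next
      case (Some y)
      then show ?thesis using u fin closed[of u y] f[of u y] by simp
    qed
    finally show "(\<Sum>v\<in>V. step_mat f u v * of_bool (v \<in> U)) = (0::'b)" .
  qed
qed

definition parent_maps :: "'a set \<Rightarrow> ('a \<Rightarrow> 'a set) \<Rightarrow> ('a \<Rightarrow> 'a option) set" where
  "parent_maps V nb = {f \<in> PiE V (\<lambda>v. insert None (Some ` nb v)). ranked V f}"

text \<open>
  Row \<open>u\<close> of \<open>x I + L\<close> is the sum of the rows \<open>e_u - e_w\<close> over the neighbours \<open>w\<close> of \<open>u\<close> and of
  \<open>x\<close> times the row \<open>e_u\<close>, the last one standing for a step from \<open>u\<close> to \<open>None\<close>.  Since the
  determinant is linear in each row, it is the sum, over all ways to choose one summand per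
  row, of the determinants of the corresponding step matrices; these are 1 for rooted forests
  and 0 otherwise.  A root is a row where the summand with weight \<open>x\<close> was chosen.
\<close>

theorem det_Laplacian_eq_sum_parent_maps:
  fixes x :: "'b::field"
  assumes fin: "finite V" and nb: "\<And>v. v \<in> V \<Longrightarrow> nb v \<subseteq> V"
  shows "det_on V (\<lambda>u v. of_bool (u = v) * (x + of_nat (card (nb u))) - of_bool (v \<in> nb u)) =
    (\<Sum>f\<in>parent_maps V nb. x ^ card {v \<in> V. f v = None})"
proof -
  let ?e = "enum_of V" and ?N = "card V"
  let ?I = "\<lambda>v. insert None (Some ` nb v)"
  \<comment> \<open>The weight of the summand for a step to \<open>y\<close>.\<close>
  define wt where "wt y = (case y of None \<Rightarrow> x | Some _ \<Rightarrow> 1)" for y :: "'a option"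
  have fnb: "finite (nb v)" if "v \<in> V" for v using nb[OF that] fin finite_subset by blast
  have finI: "finite (?I v)" if "v \<in> V" for v using fnb[OF that] by simp
  have finPi: "finite (PiE V ?I)" using fin finI by (intro finite_PiE)
  have row: "of_bool (u = v) * (x + of_nat (card (nb u))) - of_bool (v \<in> nb u) =
      (\<Sum>y\<in>?I u. wt y * (of_bool (u = v) - of_bool (y = Some v)))" if u: "u \<in> V" for u v
  proof -
    have "(\<Sum>y\<in>?I u. wt y * (of_bool (u = v) - of_bool (y = Some v))) =
       x * of_bool (u = v) + (\<Sum>w\<in>nb u. of_bool (u = v) - of_bool (w = v))"
      using fnb[OF u] by (simp add: wt_def sum.reindex image_iff)
    also have "(\<Sum>w\<in>nb u. of_bool (u = v) - of_bool (w = v)) =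
       of_nat (card (nb u)) * of_bool (u = v) - (of_bool (v \<in> nb u) :: 'b)"
      using fnb[OF u] by (simp add: sum_subtractf of_bool_def)
    finally show ?thesis by (simp add: algebra_simps)
  qed
  have "det_on V (\<lambda>u v. of_bool (u = v) * (x + of_nat (card (nb u))) - of_bool (v \<in> nb u)) =
      (\<Sum>p | p permutes {0..<?N}. signof p * (\<Sum>f\<in>PiE V ?I.
        \<Prod>i = 0..<?N. wt (f (?e i)) * step_mat f (?e i) (?e (p i))))"
    unfolding det_on_Leibniz
  proof (rule sum.cong[OF refl], rule arg_cong[where f = "(*) _"])
    fix p
    \<comment> \<open>An inverse of the enumeration turns the product over row numbers into one over \<open>V\<close>.\<close>
    obtain e' where e': "\<And>i. i < ?N \<Longrightarrow> e' (?e i) = i"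
      using bij_betw_inv_into_left[OF bij_enum[OF fin]] by (metis atLeastLessThan_iff zero_le)
    let ?g = "\<lambda>v y. wt y * (of_bool (v = ?e (p (e' v))) - of_bool (y = Some (?e (p (e' v)))))"
    have "(\<Prod>i = 0..<?N. of_bool (?e i = ?e (p i)) * (x + of_nat (card (nb (?e i)))) -
         of_bool (?e (p i) \<in> nb (?e i))) =
       (\<Prod>i = 0..<?N. \<Sum>y\<in>?I (?e i). ?g (?e i) y)"
      using fin by (intro prod.cong refl) (simp only: row enum_mem e' atLeastLessThan_iff)
    also have "\<dots> = (\<Prod>v\<in>V. \<Sum>y\<in>?I v. ?g v y)"
      by (rule prod.reindex_bij_betw[OF bij_enum[OF fin]])
    also have "\<dots> = (\<Sum>f\<in>PiE V ?I. \<Prod>v\<in>V. ?g v (f v))"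
      using fin finI by (intro prod_sum_PiE)
    also have "\<dots> = (\<Sum>f\<in>PiE V ?I. \<Prod>i = 0..<?N. ?g (?e i) (f (?e i)))"
      by (intro sum.cong refl prod.reindex_bij_betw[OF bij_enum[OF fin], symmetric])
    also have "\<dots> = (\<Sum>f\<in>PiE V ?I. \<Prod>i = 0..<?N. wt (f (?e i)) * step_mat f (?e i) (?e (p i)))"
      by (intro sum.cong prod.cong refl) (simp add: e' step_mat_def)
    finally show "(\<Prod>i = 0..<?N. of_bool (?e i = ?e (p i)) * (x + of_nat (card (nb (?e i)))) -
         of_bool (?e (p i) \<in> nb (?e i))) = \<dots>" .
  qed
  also have "\<dots> = (\<Sum>f\<in>PiE V ?I. \<Sum>p | p permutes {0..<?N}. signof p *
        (\<Prod>i = 0..<?N. wt (f (?e i)) * step_mat f (?e i) (?e (p i))))"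
    unfolding sum_distrib_left by (rule sum.swap)
  also have "\<dots> = (\<Sum>f\<in>PiE V ?I. (\<Prod>v\<in>V. wt (f v)) * det_on V (step_mat f))"
  proof (rule sum.cong[OF refl])
    fix f
    have "(\<Prod>i = 0..<?N. wt (f (?e i))) = (\<Prod>v\<in>V. wt (f v))"
      by (rule prod.reindex_bij_betw[OF bij_enum[OF fin]])
    then show "(\<Sum>p | p permutes {0..<?N}. signof p *
        (\<Prod>i = 0..<?N. wt (f (?e i)) * step_mat f (?e i) (?e (p i)))) =
      (\<Prod>v\<in>V. wt (f v)) * det_on V (step_mat f)"
      by (simp add: det_on_Leibniz sum_distrib_left prod.distrib mult_ac)
  qed
  also have "\<dots> = (\<Sum>f\<in>PiE V ?I. if ranked V f then x ^ card {v \<in> V. f v = None} else 0)"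
  proof (rule sum.cong[OF refl])
    fix f assume f: "f \<in> PiE V ?I"
    have cl: "u \<in> V" if "v \<in> V" "f v = Some u" for u v
      using PiE_mem[OF f that(1)] that nb by auto
    have "(\<Prod>v\<in>V. wt (f v)) = (\<Prod>v\<in>V. if f v = None then x else 1)"
      by (intro prod.cong refl) (auto simp: wt_def split: option.split)
    also have "\<dots> = x ^ card {v \<in> V. f v = None}"
      using fin by (simp add: prod.If_cases Collect_conj_eq)
    finally show "(\<Prod>v\<in>V. wt (f v)) * det_on V (step_mat f) =
        (if ranked V f then x ^ card {v \<in> V. f v = None} else 0)"
      by (simp add: det_step_mat_ranked[OF fin] det_step_mat_not_ranked[OF fin cl])
  qed
  also have "\<dots> = (\<Sum>f\<in>parent_maps V nb. x ^ card {v \<in> V. f v = None})"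
    unfolding parent_maps_def using finPi by (simp add: sum.If_cases Collect_conj_eq)
  finally show ?thesis .
qed

section \<open>Walks and cycles in graphs\<close>

lemma uadj_sym: "uadj G u v \<longleftrightarrow> uadj G v u"
  unfolding uadj_def by (simp add: insert_commute)

lemma simple_uadj:
  assumes "simple_ugraph G" "uadj G u v"
  shows "u \<in> uverts G" "v \<in> uverts G" "u \<noteq> v"
proof -
  obtain a b where "{u, v} = {a, b}" "a \<noteq> b" "a \<in> uverts G" "b \<in> uverts G"
    using assms unfolding simple_ugraph_def uadj_def by blast
  then show "u \<in> uverts G" "v \<in> uverts G" "u \<noteq> v"
    by (auto simp: doubleton_eq_iff)
qed

lemma successively_nth:
  "successively R xs \<Longrightarrow> Suc i < length xs \<Longrightarrow> R (xs ! i) (xs ! Suc i)"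
proof (induction xs arbitrary: i)
  case (Cons x xs)
  then show ?case
    by (cases i) (auto simp: successively_Cons hd_conv_nth)
qed simp

lemma successively_imp_rtranclp:
  "successively R xs \<Longrightarrow> xs \<noteq> [] \<Longrightarrow> R\<^sup>*\<^sup>* (hd xs) (last xs)"
proof (induction xs)
  case (Cons x xs)
  then show ?case
    by (auto simp: successively_Cons intro: converse_rtranclp_into_rtranclp)
qed simp

text \<open>
  When a step leads back to the path found so far, the path is cut at that point.
\<close>

lemma rtranclp_imp_distinct_successively:
  assumes "R\<^sup>*\<^sup>* a b"
  shows "\<exists>xs. xs \<noteq> [] \<and> hd xs = a \<and> last xs = b \<and> distinct xs \<and> successively R xs"
  using assms
proof (induction rule: converse_rtranclp_induct)
  case base
  show ?case by (rule exI[of _ "[b]"]) simp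
next
  case (step a a')
  then obtain xs where xs: "xs \<noteq> []" "hd xs = a'" "last xs = b" "distinct xs" "successively R xs"
    by blast
  show ?case
  proof (cases "a \<in> set xs")
    case False
    then show ?thesis using xs step.hyps
      by (intro exI[of _ "a # xs"]) (auto simp: successively_Cons)
  next
    case True
    then obtain ys zs where "xs = ys @ a # zs" by (meson split_list)
    then show ?thesis using xs
      by (intro exI[of _ "a # zs"]) (auto simp: successively_append_iff)
  qed
qed

lemma uwalk_if_successively:
  assumes "simple_ugraph G" "xs \<noteq> []" "hd xs \<in> uverts G" "successively (uadj G) xs"
  shows "uwalk G xs"
proof -
  have "set xs \<subseteq> uverts G"
    using assms(2-4)
  proof (induction xs)
    case (Cons x xs)
    then show ?case using simple_uadj[OF assms(1)] by (cases xs) (auto simp: successively_Cons)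
  qed simp
  then show ?thesis using assms by (simp add: uwalk_def)
qed

lemma uconnected_iff_rtranclp:
  assumes "simple_ugraph G"
  shows "uconnected G \<longleftrightarrow> uverts G \<noteq> {} \<and> (\<forall>u\<in>uverts G. \<forall>v\<in>uverts G. (uadj G)\<^sup>*\<^sup>* u v)"
proof -
  have "(\<exists>xs. uwalk G xs \<and> hd xs = u \<and> last xs = v) \<longleftrightarrow> (uadj G)\<^sup>*\<^sup>* u v" if "u \<in> uverts G" for u v
    using that uwalk_if_successively[OF assms] rtranclp_imp_distinct_successively[of "uadj G" u v]
      successively_imp_rtranclp[of "uadj G"]
    unfolding uwalk_def by metis
  then show ?thesis unfolding uconnected_def by blast
qed

lemma ucycle_nth:
  assumes "ucycle G xs" "k < length xs"
  shows "uadj G (xs ! k) (xs ! ((k + 1) mod length xs))"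
proof (cases "k + 1 = length xs")
  case True
  moreover have "last xs = xs ! k" "hd xs = xs ! 0"
    using True assms by (metis add_diff_cancel_right' last_conv_nth list.size(3) not_less0,
        metis hd_conv_nth list.size(3) not_less0)
  ultimately show ?thesis using assms by (simp add: ucycle_def)
next
  case False
  then show ?thesis using assms successively_nth[of "uadj G" xs k]
    by (simp add: ucycle_def uwalk_def)
qed

section \<open>Rooted spanning trees as parent maps\<close>

text \<open>
  For a ranked map this is a forest, and a tree if there is just one root.
\<close>

definition parent_tree :: "'a set \<Rightarrow> ('a \<Rightarrow> 'a option) \<Rightarrow> 'a ugraph" where
  "parent_tree V f = (V, {{v, u} | v u. v \<in> V \<and> f v = Some u})"

abbreviation unbrs :: "'a ugraph \<Rightarrow> 'a \<Rightarrow> 'a set" where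
  "unbrs G v \<equiv> {u. uadj G v u}"

abbreviation roots :: "'a set \<Rightarrow> ('a \<Rightarrow> 'a option) \<Rightarrow> 'a set" where
  "roots V f \<equiv> {v \<in> V. f v = None}"

lemma uadj_parent_tree:
  "uadj (parent_tree V f) a b \<longleftrightarrow> a \<in> V \<and> f a = Some b \<or> b \<in> V \<and> f b = Some a"
  unfolding uadj_def parent_tree_def by (auto simp: doubleton_eq_iff)

lemma parent_maps_Some:
  assumes "simple_ugraph G" "f \<in> parent_maps (uverts G) (unbrs G)" "v \<in> uverts G" "f v = Some u"
  shows "uadj G v u" "u \<in> uverts G"
proof -
  have "f v \<in> insert None (Some ` unbrs G v)"
    using assms(2,3) unfolding parent_maps_def by (auto dest: PiE_mem)
  then show "uadj G v u" using assms(4) by auto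
  then show "u \<in> uverts G" by (rule simple_uadj(2)[OF assms(1)])
qed

text \<open>
  At a vertex of maximal rank on a cycle, both neighbours on the cycle would have to be its
  parent, but they are distinct since a cycle has length at least 3.
\<close>

lemma no_ucycle_parent_tree:
  assumes "ranked V f"
  shows "\<not> ucycle (parent_tree V f) xs"
proof
  assume cyc: "ucycle (parent_tree V f) xs"
  obtain d :: "'a \<Rightarrow> nat" where d: "\<And>v u. v \<in> V \<Longrightarrow> f v = Some u \<Longrightarrow> d u < d v"
    using assms unfolding ranked_def by blast
  let ?l = "length xs"
  have l: "?l \<ge> 3" and dist: "distinct xs" using cyc by (auto simp: ucycle_def)
  have "0 \<in> {..<?l}" using l unfolding lessThan_iff by linarith
  then have "finite {..<?l}" "{..<?l} \<noteq> {}" by blast+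
  then obtain k where k: "k < ?l" "\<And>j. j < ?l \<Longrightarrow> d (xs ! j) \<le> d (xs ! k)"
    using Max_in[of "(\<lambda>i. d (xs ! i)) ` {..<?l}"] Max_ge[of "(\<lambda>i. d (xs ! i)) ` {..<?l}"]
    by (smt (verit) finite_imageI image_iff image_is_empty lessThan_iff)
  \<comment> \<open>The positions after and before \<open>k\<close> on the cycle.\<close>
  define p where "p = (k + 1) mod ?l"
  define q where "q = (k + ?l - 1) mod ?l"
  have "?l > 0" using l by linarith
  then have pq: "p < ?l" "q < ?l" unfolding p_def q_def by (simp_all only: mod_less_divisor)
  have q1: "(q + 1) mod ?l = k"
  proof -
    have "k + ?l - 1 + 1 = k + ?l" using l by linarith
    then have "(q + 1) mod ?l = (k + ?l) mod ?l" unfolding q_def by (metis mod_add_left_eq)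
    then show ?thesis using k(1) by simp
  qed
  have neq: "p \<noteq> q"
  proof (cases "k = 0")
    case True
    then show ?thesis using l unfolding p_def q_def by simp
  next
    case False
    then have "q = k - 1" unfolding q_def using k(1) by (simp add: mod_if)
    then show ?thesis unfolding p_def using k(1) l False by (auto simp: mod_if)
  qed
  have only: "f (xs ! k) = Some (xs ! j)" if "j < ?l" "uadj (parent_tree V f) (xs ! k) (xs ! j)" for j
    using that d[of "xs ! j" "xs ! k"] k(2)[of j] unfolding uadj_parent_tree by auto
  have "uadj (parent_tree V f) (xs ! k) (xs ! p)" unfolding p_def by (rule ucycle_nth[OF cyc k(1)])
  moreover have "uadj (parent_tree V f) (xs ! k) (xs ! q)"
    using ucycle_nth[OF cyc pq(2)] unfolding q1 by (simp add: uadj_sym)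
  ultimately have "Some (xs ! p) = Some (xs ! q)" using only[OF pq(1)] only[OF pq(2)] by metis
  then have "xs ! p = xs ! q" by simp
  then show False using neq pq dist by (simp add: nth_eq_iff_index_eq)
qed

lemma parent_tree_spanning:
  assumes G: "simple_ugraph G" and f: "f \<in> parent_maps (uverts G) (unbrs G)"
    and r: "roots (uverts G) f = {r}"
  shows "parent_tree (uverts G) f \<in> spanning_utrees G"
proof -
  let ?V = "uverts G" and ?T = "parent_tree (uverts G) f"
  have rk: "ranked ?V f" using f by (simp add: parent_maps_def)
  then obtain d :: "'a \<Rightarrow> nat" where d: "\<And>v u. v \<in> ?V \<Longrightarrow> f v = Some u \<Longrightarrow> d u < d v"
    unfolding ranked_def by blast
  note fS = parent_maps_Some[OF G f]
  have vT: "uverts ?T = ?V" by (simp add: parent_tree_def)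
  have eT: "uedges ?T \<subseteq> uedges G" using fS(1) by (auto simp: parent_tree_def uadj_def)
  have T: "simple_ugraph ?T"
    using G eT unfolding simple_ugraph_def vT by blast
  have to_root: "v \<in> ?V \<Longrightarrow> (uadj ?T)\<^sup>*\<^sup>* v r" for v
  proof (induction "d v" arbitrary: v rule: less_induct)
    case less
    show ?case
    proof (cases "f v")
      case None
      then have "v = r" using r less.prems by auto
      then show ?thesis by simp
    next
      case (Some u)
      then have "uadj ?T v u" using less.prems by (simp add: uadj_parent_tree)
      moreover have "(uadj ?T)\<^sup>*\<^sup>* u r" using less Some d fS(2) by blast
      ultimately show ?thesis by (rule converse_rtranclp_into_rtranclp)
    qed
  qed
  have "symp (uadj ?T)" by (rule sympI) (simp add: uadj_sym)
  then have "symp (uadj ?T)\<^sup>*\<^sup>*" by (rule symp_rtranclp)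
  then have "(uadj ?T)\<^sup>*\<^sup>* u v" if "u \<in> ?V" "v \<in> ?V" for u v
    using to_root[OF that(1)] to_root[OF that(2)] by (meson rtranclp_trans sympD)
  moreover have "?V \<noteq> {}" using r by auto
  ultimately have "uconnected ?T" by (simp add: uconnected_iff_rtranclp[OF T] vT)
  then show ?thesis
    using T no_ucycle_parent_tree[OF rk] vT eT by (simp add: spanning_utrees_def utree_def)
qed

text \<open>
  By induction on the rank: a tree edge from \<open>v\<close> to its \<open>f\<close>-parent \<open>u\<close> is also an edge
  of the tree of \<open>g\<close>, so \<open>u\<close> is the \<open>g\<close>-parent of \<open>v\<close> unless \<open>v\<close> is the \<open>g\<close>-parent of \<open>u\<close>.  The
  latter would, by induction, make \<open>v\<close> the \<open>f\<close>-parent of \<open>u\<close> and contradict the rank of \<open>f\<close>.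
\<close>

lemma parent_tree_inj:
  assumes G: "simple_ugraph G" and f: "f \<in> parent_maps (uverts G) (unbrs G)"
    and g: "g \<in> parent_maps (uverts G) (unbrs G)"
    and roots: "roots (uverts G) f = roots (uverts G) g"
    and tree: "parent_tree (uverts G) f = parent_tree (uverts G) g"
  shows "f = g"
proof -
  let ?V = "uverts G"
  obtain d :: "'a \<Rightarrow> nat" where d: "\<And>v u. v \<in> ?V \<Longrightarrow> f v = Some u \<Longrightarrow> d u < d v"
    using f unfolding parent_maps_def ranked_def by blast
  have eq: "v \<in> ?V \<Longrightarrow> f v = g v" for v
  proof (induction "d v" arbitrary: v rule: less_induct)
    case less
    show ?case
    proof (cases "f v")
      case None
      then have "v \<in> roots ?V g" using less.prems unfolding roots[symmetric] by simp
      then show ?thesis using None by simp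
    next
      case (Some u)
      have u: "u \<in> ?V" "d u < d v"
        using parent_maps_Some[OF G f less.prems Some] d[OF less.prems Some] by auto
      then have fg: "f u = g u" by (intro less.hyps)
      have "uadj (parent_tree ?V g) v u"
        using Some less.prems unfolding tree[symmetric] by (simp add: uadj_parent_tree)
      then have "g v = Some u \<or> g u = Some v" by (auto simp: uadj_parent_tree)
      then show ?thesis using Some fg d[OF u(1), of v] u(2) by auto
    qed
  qed
  show ?thesis
    using f g unfolding parent_maps_def by (auto intro: PiE_ext eq)
qed

text \<open>
  Orient the tree towards \<open>r\<close>: the parent of a vertex is a neighbour that is closer to \<open>r\<close>,
  and the distance from \<open>r\<close> is a rank.  This uses up all edges of \<open>T\<close>, because an edge of \<open>T\<close>
  that was left out would close a cycle with the path between its ends in the parent tree.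
\<close>

lemma spanning_utree_has_parent_map:
  assumes G: "simple_ugraph G" and T: "T \<in> spanning_utrees G" and r: "r \<in> uverts G"
  shows "\<exists>f\<in>parent_maps (uverts G) (unbrs G). roots (uverts G) f = {r} \<and> parent_tree (uverts G) f = T"
proof -
  let ?V = "uverts G"
  have sT: "simple_ugraph T" and cT: "uconnected T" and aT: "\<And>xs. \<not> ucycle T xs"
    and vT: "uverts T = ?V" and eT: "uedges T \<subseteq> uedges G"
    using T by (auto simp: spanning_utrees_def utree_def)
  have TG: "uadj G u v" if "uadj T u v" for u v using that eT by (auto simp: uadj_def)
  \<comment> \<open>The distance from \<open>v\<close> to \<open>r\<close> in \<open>T\<close>.\<close>
  define d where "d v = (LEAST k. (uadj T ^^ k) v r)" for v
  define f where "f = restrict (\<lambda>v. if v = r then None else Some (SOME u. uadj T v u \<and> d u < d v)) ?V"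
  have closer: "\<exists>u. uadj T v u \<and> d u < d v" if v: "v \<in> ?V" "v \<noteq> r" for v
  proof -
    have "(uadj T)\<^sup>*\<^sup>* v r" using cT v r uconnected_iff_rtranclp[OF sT] vT by simp
    then have "\<exists>k. (uadj T ^^ k) v r" by (simp add: rtranclp_power)
    then have *: "(uadj T ^^ d v) v r" unfolding d_def by (rule LeastI_ex)
    then obtain k where k: "d v = Suc k" using v(2) by (cases "d v") auto
    then obtain u where u: "uadj T v u" "(uadj T ^^ k) u r" using * by (metis relpowp_Suc_E2)
    then have "d u \<le> k" unfolding d_def by (intro Least_le)
    then show ?thesis using u k by auto
  qed
  have fS: "uadj T v u \<and> d u < d v" if "v \<in> ?V" "f v = Some u" for u v
  proof -
    have "v \<noteq> r" "u = (SOME u. uadj T v u \<and> d u < d v)"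
      using that by (auto simp: f_def split: if_splits)
    then show ?thesis using someI_ex[OF closer[OF that(1)]] by simp
  qed
  have fN: "f v = None \<longleftrightarrow> v = r" if "v \<in> ?V" for v
    using that by (simp add: f_def)
  have "f v \<in> insert None (Some ` unbrs G v)" if "v \<in> ?V" for v
    using fS[OF that] TG by (cases "f v") auto
  moreover have "f \<in> extensional ?V" by (simp add: f_def)
  ultimately have "f \<in> PiE ?V (\<lambda>v. insert None (Some ` unbrs G v))"
    by (intro PiE_I) (auto simp: extensional_def)
  moreover have "ranked ?V f" unfolding ranked_def using fS by blast
  ultimately have f: "f \<in> parent_maps ?V (unbrs G)" by (simp add: parent_maps_def)
  have roots: "roots ?V f = {r}" using fN r by auto
  let ?T = "parent_tree ?V f"
  have "?T \<in> spanning_utrees G" by (rule parent_tree_spanning[OF G f roots])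
  then have sT': "simple_ugraph ?T" and cT': "uconnected ?T"
    by (auto simp: spanning_utrees_def utree_def)
  have vT': "uverts ?T = ?V" by (simp add: parent_tree_def)
  have T'T: "uadj T a b" if "uadj ?T a b" for a b
    using that fS uadj_sym[of T] unfolding uadj_parent_tree by blast
  have TT': "uadj ?T a b" if ab: "uadj T a b" for a b
  proof (rule ccontr)
    assume nab: "\<not> uadj ?T a b"
    have V: "a \<in> ?V" "b \<in> ?V" "a \<noteq> b" using simple_uadj[OF sT ab] vT by auto
    then have "(uadj ?T)\<^sup>*\<^sup>* a b" using cT' uconnected_iff_rtranclp[OF sT'] vT' by simp
    then obtain xs where xs: "xs \<noteq> []" "hd xs = a" "last xs = b" "distinct xs"
      "successively (uadj ?T) xs"
      using rtranclp_imp_distinct_successively by metis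
    have "length xs \<ge> 3"
    proof (rule ccontr)
      assume "\<not> length xs \<ge> 3"
      then have "length xs = 1 \<or> length xs = 2" using xs(1)
        unfolding length_greater_0_conv[symmetric] by linarith
      then show False using xs V(3) nab by (auto simp: length_Suc_conv numeral_2_eq_2)
    qed
    moreover have "successively (uadj T) xs"
      using xs(5) by (rule successively_mono) (rule T'T)
    then have "uwalk T xs" using uwalk_if_successively[OF sT xs(1)] xs(2) V(1) vT by simp
    ultimately have "ucycle T xs" using xs ab by (simp add: ucycle_def uadj_sym)
    then show False using aT by blast
  qed
  have "uedges T = uedges ?T"
  proof (rule Set.set_eqI)
    fix e
    have ex: "\<exists>a b. e = {a, b}" if "e \<in> uedges H" "simple_ugraph H" for H :: "'a ugraph"
      using that unfolding simple_ugraph_def by blast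
    show "e \<in> uedges T \<longleftrightarrow> e \<in> uedges ?T"
    proof
      assume e: "e \<in> uedges T"
      then obtain a b where "e = {a, b}" using ex[OF _ sT] by blast
      then show "e \<in> uedges ?T" using TT'[of a b] e by (simp add: uadj_def)
    next
      assume e: "e \<in> uedges ?T"
      then obtain a b where "e = {a, b}" using ex[OF _ sT'] by blast
      then show "e \<in> uedges T" using T'T[of a b] e by (simp add: uadj_def)
    qed
  qed
  then have "?T = T" using vT vT' by (simp add: prod_eq_iff)
  then show ?thesis using f roots by blast
qed

text \<open>
  A spanning tree can be oriented towards each of its vertices in exactly one way, whence the
  second factor.
\<close>

theorem card_parent_maps_one_root:
  assumes G: "simple_ugraph G"
  shows "card {f \<in> parent_maps (uverts G) (unbrs G). card (roots (uverts G) f) = 1} =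
    card (spanning_utrees G) * card (uverts G)"
proof -
  let ?V = "uverts G"
  let ?F = "{f \<in> parent_maps ?V (unbrs G). card (roots ?V f) = 1}"
  let ?h = "\<lambda>f. (parent_tree ?V f, THE r. roots ?V f = {r})"
  have "bij_betw ?h ?F (spanning_utrees G \<times> ?V)"
  proof (rule bij_betw_imageI)
    show "inj_on ?h ?F"
    proof (rule inj_onI)
      fix f g assume fg: "f \<in> ?F" "g \<in> ?F" "?h f = ?h g"
      obtain r s where rs: "roots ?V f = {r}" "roots ?V g = {s}"
        using fg(1,2) by (auto simp: card_1_singleton_iff)
      have "r = s" using fg(3) unfolding rs by simp
      then show "f = g" using parent_tree_inj[OF G, of f g] fg rs by simp
    qed
    show "?h ` ?F = spanning_utrees G \<times> ?V"
    proof (intro equalityI subsetI)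
      fix y assume "y \<in> ?h ` ?F"
      then obtain f where f: "f \<in> ?F" "y = ?h f" by blast
      then obtain r where r: "roots ?V f = {r}" by (auto simp: card_1_singleton_iff)
      have "r \<in> ?V" using r by blast
      moreover have "y = (parent_tree ?V f, r)" using f(2) unfolding r by simp
      ultimately show "y \<in> spanning_utrees G \<times> ?V"
        using parent_tree_spanning[OF G _ r] f(1) by simp
    next
      fix y assume "y \<in> spanning_utrees G \<times> ?V"
      then obtain T r where y: "y = (T, r)" "T \<in> spanning_utrees G" "r \<in> ?V" by blast
      obtain f where f: "f \<in> parent_maps ?V (unbrs G)" "roots ?V f = {r}" "parent_tree ?V f = T"
        using spanning_utree_has_parent_map[OF G y(2,3)] by blast
      have "?h f = y" unfolding f(2,3) y(1) by simp
      then show "y \<in> ?h ` ?F" using f by (intro image_eqI[of _ _ f]) auto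
    qed
  qed
  then show ?thesis by (simp add: bij_betw_same_card card_cartesian_product)
qed

section \<open>The matrix-tree theorem\<close>

text \<open>
  By the expansion into parent maps, \<open>det (x I + L)\<close> is a polynomial in \<open>x\<close> that counts rooted
  spanning forests by their number of roots.  Each forest has a root, so \<open>x\<close> can be divided out,
  and the value at 0 of the quotient counts the forests with exactly one root.  The
  quotient is allowed to be any function \<open>g\<close> continuous at 0, so that a factored form of
  the determinant can be used without treating it as a polynomial.
\<close>

theorem matrix_tree:
  fixes g :: "complex \<Rightarrow> complex"
  assumes G: "simple_ugraph G" and ne: "uverts G \<noteq> {}" and cont: "isCont g 0"
    and det: "\<And>x. x \<noteq> 0 \<Longrightarrow> det_on (uverts G)
      (\<lambda>u v. of_bool (u = v) * (x + of_nat (card (unbrs G u))) - of_bool (v \<in> unbrs G u)) = x * g x"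
  shows "of_nat (card (spanning_utrees G) * card (uverts G)) = g 0"
proof -
  let ?V = "uverts G" and ?P = "parent_maps (uverts G) (unbrs G)"
  let ?r = "\<lambda>f. card (roots ?V f)"
  have fin: "finite ?V" using G by (simp add: simple_ugraph_def)
  have nb: "unbrs G v \<subseteq> ?V" for v using simple_uadj[OF G] by blast
  have finP: "finite ?P"
  proof (rule finite_subset)
    show "?P \<subseteq> PiE ?V (\<lambda>v. insert None (Some ` unbrs G v))" by (auto simp: parent_maps_def)
    show "finite (PiE ?V (\<lambda>v. insert None (Some ` unbrs G v)))"
      using fin nb by (intro finite_PiE) (auto intro: finite_subset)
  qed
  \<comment> \<open>A vertex of least rank is a root.\<close>
  have pos: "?r f > 0" if f: "f \<in> ?P" for f
  proof -
    obtain d :: "'a \<Rightarrow> nat" where d: "\<And>v u. v \<in> ?V \<Longrightarrow> f v = Some u \<Longrightarrow> d u < d v"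
      using f unfolding parent_maps_def ranked_def by blast
    obtain v where v: "v \<in> ?V" "\<And>u. u \<in> ?V \<Longrightarrow> d v \<le> d u"
      using ne ex_has_least_nat[of "\<lambda>v. v \<in> ?V" _ d] by blast
    have "f v = None"
    proof (cases "f v")
      case (Some u)
      then show ?thesis
        using d[OF v(1) Some] v(2)[OF parent_maps_Some(2)[OF G f v(1) Some]] by simp
    qed
    then have "v \<in> roots ?V f" using v by simp
    then show ?thesis using fin by (auto simp: card_gt_0_iff)
  qed
  have eq: "(\<Sum>f\<in>?P. x ^ (?r f - 1)) = g x" if x: "x \<noteq> 0" for x :: complex
  proof -
    have "x * (\<Sum>f\<in>?P. x ^ (?r f - 1)) = (\<Sum>f\<in>?P. x ^ ?r f)"
      unfolding sum_distrib_left
    proof (rule sum.cong[OF refl])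
      fix f assume "f \<in> ?P"
      then show "x * x ^ (?r f - 1) = x ^ ?r f"
        using pos[of f] by (simp only: power_eq_if[of x "?r f"] if_False gr0_conv_Suc) auto
    qed
    also have "\<dots> = x * g x"
      using det[OF x] det_Laplacian_eq_sum_parent_maps[OF fin nb, of x] by simp
    finally show ?thesis using x by simp
  qed
  let ?s = "\<lambda>x :: complex. \<Sum>f\<in>?P. x ^ (?r f - 1)"
  have "(?s \<longlongrightarrow> ?s 0) (at 0)" by (intro tendsto_intros)
  then have "(g \<longlongrightarrow> ?s 0) (at 0)"
  proof (rule Lim_transform_eventually)
    show "\<forall>\<^sub>F x in at 0. ?s x = g x"
      unfolding eventually_at_filter by (intro always_eventually allI impI eq)
  qed
  then have "?s 0 = g 0" using cont by (intro LIM_unique[of g _ 0]) (auto simp: isCont_def)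
  moreover have "?s 0 = (\<Sum>f\<in>?P. if ?r f = 1 then 1 else 0)"
  proof (rule sum.cong[OF refl])
    fix f assume "f \<in> ?P"
    then show "(0 :: complex) ^ (?r f - 1) = (if ?r f = 1 then 1 else 0)"
      using pos[of f] by (cases "?r f = 1") (auto simp only: power_0_left, auto)
  qed
  also have "\<dots> = of_nat (card {f \<in> ?P. ?r f = 1})"
    using finP by (simp add: sum.If_cases Collect_conj_eq)
  finally show ?thesis using card_parent_maps_one_root[OF G] by simp
qed

section \<open>Products over roots of unity\<close>

definition unit_root :: "nat \<Rightarrow> complex" where
  "unit_root n = cis (2 * pi / real n)"

lemma unit_root_power: "unit_root n ^ k = cis (2 * pi * real k / real n)"
  unfolding unit_root_def DeMoivre by (simp add: mult_ac)

lemma bij_unit_root: "n > 0 \<Longrightarrow> bij_betw (\<lambda>k. unit_root n ^ k) {..<n} {z. z ^ n = 1}"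
  unfolding unit_root_power by (rule bij_betw_roots_unity)

lemma unit_root_pow_pow: "n > 0 \<Longrightarrow> (unit_root n ^ k) ^ n = 1"
proof -
  assume n: "n > 0"
  have "unit_root n ^ n = 1" unfolding unit_root_power using n by simp
  then have "(unit_root n ^ n) ^ k = 1" by simp
  then show ?thesis by (simp add: mult.commute flip: power_mult)
qed

lemma unit_root_nz [simp]: "unit_root n \<noteq> 0"
  by (simp add: unit_root_def)

lemma cnj_unit_root: "cnj (unit_root n ^ k) = inverse (unit_root n ^ k)"
  unfolding unit_root_def complex_cnj_power cis_cnj power_inverse[symmetric] cis_inverse ..

lemma unit_root_eq_iff:
  assumes "i < n" "j < n"
  shows "unit_root n ^ i = unit_root n ^ j \<longleftrightarrow> i = j"
  using bij_unit_root[of n] assms by (auto simp: bij_betw_def inj_on_def)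

lemma sum_powers_unit:
  fixes z :: complex
  assumes "z ^ n = 1"
  shows "(\<Sum>k<n. z ^ k) = of_nat n * of_bool (z = 1)"
  using assms by (cases "z = 1") (auto simp: geometric_sum)

lemma prod_unit_root_poly:
  assumes n: "n > 0"
  shows "(\<Prod>b<n. z - unit_root n ^ b) = z ^ n - 1"
proof -
  let ?p = "monom 1 n - 1 :: complex poly"
  have root: "poly ?p z = 0 \<longleftrightarrow> z ^ n = 1" for z by (simp add: poly_monom)
  have deg: "degree ?p = n" using n
    by (simp add: diff_conv_add_uminus degree_add_eq_left degree_monom_eq del: add_uminus_conv_diff)
  have lc: "lead_coeff ?p = 1" using n unfolding deg by simp
  \<comment> \<open>The roots are simple, so the polynomial is the product of its distinct linear factors.\<close>
  have "poly (pderiv ?p) z \<noteq> 0" if "poly ?p z = 0" for z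
  proof -
    have "z \<noteq> 0" using that n unfolding root by (auto simp: power_0_left)
    then show ?thesis using n by (simp add: pderiv_diff pderiv_monom poly_monom)
  qed
  then have "rsquarefree ?p" by (auto simp: rsquarefree_roots)
  then have "(\<Prod>z | poly ?p z = 0. [:- z, 1:]) = ?p"
    using complex_poly_decompose_rsquarefree[of ?p] unfolding lc by simp
  then have "poly (\<Prod>z | poly ?p z = 0. [:- z, 1:]) z = poly ?p z" by simp
  then have "(\<Prod>w | w ^ n = 1. z - w) = z ^ n - 1"
    unfolding root by (simp add: poly_prod poly_monom)
  then show ?thesis
    using prod.reindex_bij_betw[OF bij_unit_root[OF n], of "\<lambda>w. z - w"] by simp
qed

text \<open>
  For \<open>z \<noteq> 1\<close> both \<open>\<Prod>b = 1..<n. z - unit_root n ^ b\<close> and \<open>\<Sum>k<n. z ^ k\<close> equal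
  \<open>(z ^ n - 1) / (z - 1)\<close>; the claim compares their values at \<open>z = 1\<close>, which agree by
  continuity.
\<close>

lemma prod_one_minus_unit_root:
  assumes n: "n > 0"
  shows "(\<Prod>b = 1..<n. 1 - unit_root n ^ b) = of_nat n"
proof -
  let ?l = "\<lambda>z. \<Prod>b = 1..<n. z - unit_root n ^ b" and ?s = "\<lambda>z::complex. \<Sum>k<n. z ^ k"
  have split: "{..<n} = insert 0 {1..<n}" using n by auto
  have eq: "?l z = ?s z" if "z \<noteq> 1" for z
  proof -
    have "(z - 1) * ?l z = z ^ n - 1"
      using prod_unit_root_poly[OF n, of z] unfolding split by simp
    then show ?thesis using that by (simp add: geometric_sum field_simps)
  qed
  have l: "(?l \<longlongrightarrow> ?l 1) (at 1)" and s: "(?s \<longlongrightarrow> ?s 1) (at 1)" by (intro tendsto_intros)+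
  from l have "(?s \<longlongrightarrow> ?l 1) (at 1)"
  proof (rule Lim_transform_eventually)
    show "\<forall>\<^sub>F z in at 1. ?l z = ?s z"
      unfolding eventually_at_filter by (intro always_eventually allI impI eq)
  qed
  then have "?l 1 = ?s 1" using s by (rule LIM_unique)
  then show ?thesis by simp
qed

text \<open>
  This is the determinant of \<open>y I + L\<close> for the Laplacian \<open>L\<close> of the cycle with \<open>n \<ge> 3\<close> vertices,
  written as the product of the eigenvalues.
\<close>

definition cycle_poly :: "nat \<Rightarrow> complex \<Rightarrow> complex" where
  "cycle_poly n y = (\<Prod>b<n. y + 2 - unit_root n ^ b - inverse (unit_root n ^ b))"

text \<open>
  Each factor splits as \<open>(\<alpha> - w) * (\<alpha> - 1 / w) * \<beta>\<close>, and the products of the first two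
  kinds of factors over all \<open>n\<close>-th roots of unity \<open>w\<close> are both \<open>\<alpha> ^ n - 1\<close>.
\<close>

lemma cycle_poly_eq:
  assumes n: "n > 0" and ab: "\<alpha> * \<beta> = 1" and y: "y = \<alpha> + \<beta> - 2"
  shows "cycle_poly n y = \<alpha> ^ n + \<beta> ^ n - 2"
proof -
  let ?w = "\<lambda>b. unit_root n ^ b"
  have "(y + 2 - ?w b - inverse (?w b)) = (\<alpha> - ?w b) * ((\<alpha> - cnj (?w b)) * \<beta>)" for b
  proof -
    let ?c = "cnj (?w b)"
    have "(\<alpha> - ?w b) * ((\<alpha> - ?c) * \<beta>) = \<alpha> * (\<alpha> * \<beta>) - (\<alpha> * \<beta>) * ?c - ?w b * (\<alpha> * \<beta>) + ?w b * ?c * \<beta>"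
      by (simp only: algebra_simps)
    moreover have "?w b * ?c = 1" unfolding cnj_unit_root by simp
    ultimately show ?thesis using y by (simp only: ab cnj_unit_root) simp
  qed
  then have "cycle_poly n y = (\<Prod>b<n. \<alpha> - ?w b) * ((\<Prod>b<n. \<alpha> - cnj (?w b)) * \<beta> ^ n)"
    unfolding cycle_poly_def by (simp add: prod.distrib)
  also have "(\<Prod>b<n. \<alpha> - cnj (?w b)) = cnj (\<Prod>b<n. cnj \<alpha> - ?w b)" by simp
  also have "\<dots> = \<alpha> ^ n - 1" unfolding prod_unit_root_poly[OF n] by simp
  also have "(\<Prod>b<n. \<alpha> - ?w b) = \<alpha> ^ n - 1" by (rule prod_unit_root_poly[OF n])
  finally have "cycle_poly n y = (\<alpha> ^ n - 1) * (\<alpha> ^ n * \<beta> ^ n - \<beta> ^ n)" by (simp add: algebra_simps)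
  also have "\<alpha> ^ n * \<beta> ^ n = 1" using ab by (simp flip: power_mult_distrib)
  finally have "cycle_poly n y = \<alpha> ^ n - \<alpha> ^ n * \<beta> ^ n - 1 + \<beta> ^ n" by (simp add: algebra_simps)
  then show ?thesis using \<open>\<alpha> ^ n * \<beta> ^ n = 1\<close> by simp
qed

text \<open>
  The factor \<open>y\<close>, which belongs to the eigenvalue 0 of the Laplacian, is left out.
\<close>

definition cycle_poly_red :: "nat \<Rightarrow> complex \<Rightarrow> complex" where
  "cycle_poly_red n y = (\<Prod>b = 1..<n. y + 2 - unit_root n ^ b - inverse (unit_root n ^ b))"

lemma cycle_poly_red: "n > 0 \<Longrightarrow> cycle_poly n y = y * cycle_poly_red n y"
proof -
  assume n: "n > 0"
  have split: "{..<n} = insert 0 {1..<n}" using n by auto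
  show ?thesis unfolding cycle_poly_def cycle_poly_red_def split by simp
qed

lemma cycle_poly_red_0:
  assumes n: "n > 0"
  shows "cycle_poly_red n 0 = (of_nat n)\<^sup>2"
proof -
  let ?w = "\<lambda>b. unit_root n ^ b"
  have "0 + 2 - ?w b - inverse (?w b) = (1 - ?w b) * cnj (1 - ?w b)" for b
    unfolding complex_cnj_diff cnj_unit_root by (simp add: field_simps)
  then have "cycle_poly_red n 0 = (\<Prod>b = 1..<n. 1 - ?w b) * cnj (\<Prod>b = 1..<n. 1 - ?w b)"
    unfolding cycle_poly_red_def cnj_prod by (simp only: prod.distrib)
  then show ?thesis unfolding prod_one_minus_unit_root[OF n] by (simp add: power2_eq_square)
qed

lemma isCont_cycle_poly [continuous_intros]:
  "isCont f a \<Longrightarrow> isCont (\<lambda>x. cycle_poly n (f x)) a"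
  unfolding cycle_poly_def by (intro continuous_intros)

lemma isCont_cycle_poly_red [continuous_intros]:
  "isCont f a \<Longrightarrow> isCont (\<lambda>x. cycle_poly_red n (f x)) a"
  unfolding cycle_poly_red_def by (intro continuous_intros)

section \<open>The product of a complete graph and a cycle\<close>

lemma uadj_complete: "uadj (complete_ugraph m) u v \<longleftrightarrow> u < m \<and> v < m \<and> u \<noteq> v"
  unfolding uadj_def complete_ugraph_def by (auto simp: doubleton_eq_iff)

lemma uadj_cycle:
  assumes "n > 0"
  shows "uadj (cycle_ugraph n) i j \<longleftrightarrow> i < n \<and> j < n \<and> (j = (i + 1) mod n \<or> i = (j + 1) mod n)"
  unfolding uadj_def cycle_ugraph_def using assms by (auto simp: doubleton_eq_iff)

lemma cycle_succ:
  fixes j n :: nat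
  assumes "j < n"
  shows "(j + 1) mod n = (if j + 1 = n then 0 else j + 1)"
  using assms by simp

lemma cycle_pred:
  fixes j n :: nat
  assumes "j < n"
  shows "(j + n - 1) mod n = (if j = 0 then n - 1 else j - 1)"
proof (cases "j = 0")
  case False
  then have "j + n - 1 = (j - 1) + n" by simp
  then have "(j + n - 1) mod n = (j - 1) mod n" by (simp only: mod_add_self2)
  then show ?thesis using assms False by simp
qed (use assms in simp)

lemma cycle_pred_iff:
  fixes i j n :: nat
  assumes "i < n" "j < n"
  shows "i = (j + 1) mod n \<longleftrightarrow> j = (i + n - 1) mod n"
  unfolding cycle_succ[OF assms(2)] cycle_pred[OF assms(1)] using assms by auto

abbreviation (input) "prism m n \<equiv> cartesian_ugraph (complete_ugraph m) (cycle_ugraph n)"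

lemma uverts_complete: "uverts (complete_ugraph m) = {..<m}"
  by (auto simp: complete_ugraph_def)

lemma uverts_cycle: "uverts (cycle_ugraph n) = {..<n}"
  by (auto simp: cycle_ugraph_def)

lemma uverts_prism: "uverts (prism m n) = {..<m} \<times> {..<n}"
  by (simp add: cartesian_ugraph_def uverts_complete uverts_cycle)

lemma unbrs_prism:
  assumes n: "n > 0" and ij: "i < m" "j < n"
  shows "unbrs (prism m n) (i, j) =
    ({..<m} - {i}) \<times> {j} \<union> {i} \<times> {(j + 1) mod n, (j + n - 1) mod n}"
proof -
  have "uadj (prism m n) (i, j) (k, l) \<longleftrightarrow>
     k < m \<and> k \<noteq> i \<and> l = j \<or> k = i \<and> (l = (j + 1) mod n \<or> l = (j + n - 1) mod n)" for k l
  proof -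
    have "(j + 1) mod n < n" "(j + n - 1) mod n < n" using n by simp_all
    then show ?thesis
      unfolding uadj_cartesian_ugraph uverts_complete uverts_cycle uadj_complete uadj_cycle[OF n]
      using ij cycle_pred_iff[of j n l] by blast
  qed
  then show ?thesis by (intro Set.set_eqI) (simp only: split_paired_all mem_Collect_eq, blast)
qed

lemma sum_unbrs_prism:
  fixes h :: "nat \<times> nat \<Rightarrow> 'b::comm_ring_1"
  assumes n: "n \<ge> 3" and ij: "i < m" "j < n"
  shows "(\<Sum>w\<in>unbrs (prism m n) (i, j). h w) =
    (\<Sum>k<m. h (k, j)) - h (i, j) + h (i, (j + 1) mod n) + h (i, (j + n - 1) mod n)"
proof -
  have ne: "(j + 1) mod n \<noteq> j" "(j + n - 1) mod n \<noteq> j" "(j + 1) mod n \<noteq> (j + n - 1) mod n"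
    unfolding cycle_succ[OF ij(2)] cycle_pred[OF ij(2)] using n ij by auto
  have "(\<Sum>w\<in>unbrs (prism m n) (i, j). h w) =
    (\<Sum>w\<in>({..<m} - {i}) \<times> {j}. h w) + (\<Sum>w\<in>{i} \<times> {(j + 1) mod n, (j + n - 1) mod n}. h w)"
  proof -
    have n0: "n > 0" using n by linarith
    show ?thesis unfolding unbrs_prism[OF n0 ij] by (rule sum.union_disjoint) auto
  qed
  also have "(\<Sum>w\<in>({..<m} - {i}) \<times> {j}. h w) = (\<Sum>k\<in>{..<m} - {i}. h (k, j))"
    by (rule sum.reindex_bij_witness[of _ "\<lambda>k. (k, j)" fst]) auto
  also have "\<dots> = (\<Sum>k<m. h (k, j)) - h (i, j)"
    using ij by (simp add: sum_diff1)
  also have "(\<Sum>w\<in>{i} \<times> {(j + 1) mod n, (j + n - 1) mod n}. h w) =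
      h (i, (j + 1) mod n) + h (i, (j + n - 1) mod n)"
    using ne(3) by simp
  finally show ?thesis by (simp add: algebra_simps)
qed

lemma card_unbrs_prism:
  assumes "n \<ge> 3" "i < m" "j < n"
  shows "(of_nat (card (unbrs (prism m n) (i, j))) :: 'b::comm_ring_1) = of_nat m + 1"
  using sum_unbrs_prism[OF assms, of "\<lambda>_. 1 :: 'b"] by simp

lemma power_mod_unit:
  fixes z :: "'b::monoid_mult"
  assumes "z ^ n = 1"
  shows "z ^ (k mod n) = z ^ k"
proof -
  have "z ^ k = z ^ (n * (k div n) + k mod n)" by simp
  also have "\<dots> = z ^ (k mod n)" unfolding power_add power_mult assms by simp
  finally show ?thesis by simp
qed

text \<open>
  The characters of the group \<open>Z_m \<times> Z_n\<close>, indexed by \<open>(a, b)\<close>, are eigenvectors of the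
  Laplacian.  The complete graph contributes the eigenvalue 0 for \<open>a = 0\<close> and \<open>m\<close> for the \<open>m - 1\<close>
  other values of \<open>a\<close>; the cycle contributes \<open>2 - w - 1 / w\<close> with \<open>w = unit_root n ^ b\<close>.
\<close>

lemma det_Laplacian_prism:
  fixes x :: complex
  assumes m: "m > 0" and n: "n \<ge> 3"
  shows "det_on (uverts (prism m n)) (\<lambda>u v. of_bool (u = v) *
      (x + of_nat (card (unbrs (prism m n) u))) - of_bool (v \<in> unbrs (prism m n) u)) =
    cycle_poly n x * cycle_poly n (x + of_nat m) ^ (m - 1)"
proof -
  let ?V = "{..<m} \<times> {..<n}" and ?nb = "unbrs (prism m n)"
  let ?p = "unit_root m" and ?w = "unit_root n"
  \<comment> \<open>Column \<open>v = (a, b)\<close> of \<open>F\<close> is the character with index \<open>(a, b)\<close>.\<close>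
  define F :: "nat \<times> nat \<Rightarrow> nat \<times> nat \<Rightarrow> complex" where
    "F u v = (?p ^ fst v) ^ fst u * (?w ^ snd v) ^ snd u" for u v
  define H where "H u v = inverse (F v u)" for u v
  define d :: "nat \<times> nat \<Rightarrow> complex" where
    "d v = x + of_nat m * of_bool (fst v \<noteq> 0) + 2 - ?w ^ snd v - inverse (?w ^ snd v)" for v
  have n0: "n > 0" using n by simp
  have simp_G: "simple_ugraph (prism m n)"
    by (intro simple_cartesian_ugraph simple_complete_ugraph simple_cycle_ugraph n)
  have nbV: "?nb u \<subseteq> ?V" for u using simple_uadj[OF simp_G] unfolding uverts_prism by blast
  have "det_on ?V (\<lambda>u v. of_bool (u = v) * (x + of_nat (card (?nb u))) - of_bool (v \<in> ?nb u)) =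
    (\<Prod>v\<in>?V. d v)"
  proof (rule det_on_diagonalize[where F = F and G = H and c = "of_nat (m * n)"])
    show "finite ?V" by simp
    show "of_nat (m * n) \<noteq> (0 :: complex)" using m n by simp
  next
    fix u v assume u: "u \<in> ?V" and v: "v \<in> ?V"
    obtain i j a b where uv: "u = (i, j)" "v = (a, b)" by (cases u, cases v)
    have ij: "i < m" "j < n" "a < m" "b < n" using u v uv by auto
    have wn: "(?w ^ b) ^ n = 1" by (rule unit_root_pow_pow[OF n0])
    have succ: "(?w ^ b) ^ ((j + 1) mod n) = (?w ^ b) ^ j * ?w ^ b"
      unfolding power_mod_unit[OF wn] by simp
    have "(?w ^ b) ^ ((j + n - 1) mod n) * ?w ^ b = (?w ^ b) ^ (j + n - 1 + 1)"
      unfolding power_mod_unit[OF wn] by (simp only: power_add power_one_right)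
    also have "\<dots> = (?w ^ b) ^ j"
      using n0 by (simp only: power_add wn le_add_diff_inverse2)
        (simp add: power_add wn)
    finally have pred: "(?w ^ b) ^ ((j + n - 1) mod n) = (?w ^ b) ^ j * inverse (?w ^ b)"
      by (simp add: field_simps)
    have "?p ^ a = 1 \<longleftrightarrow> a = 0" using unit_root_eq_iff[of a m 0] ij by simp
    then have psum: "(\<Sum>k<m. (?p ^ a) ^ k) = of_nat m * of_bool (a = 0) * (?p ^ a) ^ i"
      using sum_powers_unit[OF unit_root_pow_pow[of m a]] m by auto
    have "(\<Sum>w\<in>?V. (of_bool (u = w) * (x + of_nat (card (?nb u))) - of_bool (w \<in> ?nb u)) * F w v) =
      (\<Sum>w\<in>?V. if w = u then (x + of_nat (card (?nb u))) * F w v else 0) -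
      (\<Sum>w\<in>?V. if w \<in> ?nb u then F w v else 0)"
      unfolding sum_subtractf[symmetric] by (intro sum.cong refl) (auto simp: algebra_simps)
    also have "(\<Sum>w\<in>?V. if w \<in> ?nb u then F w v else 0) = (\<Sum>w\<in>?nb u. F w v)"
      using nbV[of u] by (simp only: sum.inter_restrict[symmetric] finite_cartesian_product
          finite_lessThan Int_absorb1)
    also have "\<dots> = (\<Sum>k<m. (?p ^ a) ^ k) * (?w ^ b) ^ j - F u v
        + F u v * ?w ^ b + F u v * inverse (?w ^ b)"
      unfolding uv sum_unbrs_prism[OF n ij(1,2)] F_def
      by (simp only: fst_conv snd_conv succ pred sum_distrib_right mult.assoc)
    also have "(\<Sum>k<m. (?p ^ a) ^ k) * (?w ^ b) ^ j = of_nat m * of_bool (a = 0) * F u v"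
      unfolding psum by (simp add: F_def uv)
    also have "(\<Sum>w\<in>?V. if w = u then (x + of_nat (card (?nb u))) * F w v else 0) =
        (x + of_nat m + 1) * F u v"
      using u card_unbrs_prism[OF n ij(1,2), where 'b = complex] by (simp add: uv)
    also have "(x + of_nat m + 1) * F u v - (of_nat m * of_bool (a = 0) * F u v - F u v
        + F u v * ?w ^ b + F u v * inverse (?w ^ b)) = F u v * d v"
      by (cases "a = 0") (simp_all add: d_def uv algebra_simps)
    finally show "(\<Sum>w\<in>?V. (of_bool (u = w) * (x + of_nat (card (?nb u))) - of_bool (w \<in> ?nb u)) * F w v)
      = F u v * d v" .
  next
    fix u v assume u: "u \<in> ?V" and v: "v \<in> ?V"
    obtain i j k l where uv: "u = (i, j)" "v = (k, l)" by (cases u, cases v)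
    have ij: "i < m" "j < n" "k < m" "l < n" using u v uv by auto
    \<comment> \<open>Orthogonality of characters.\<close>
    have orth: "(\<Sum>a<N. (unit_root N ^ s / unit_root N ^ t) ^ a) = of_nat N * of_bool (s = t)"
      if "s < N" "t < N" for N s t
    proof -
      have "(unit_root N ^ s / unit_root N ^ t) ^ N = 1"
        using that by (simp add: power_divide unit_root_pow_pow)
      then show ?thesis
        using sum_powers_unit unit_root_eq_iff[OF that] by simp
    qed
    have "(\<Sum>w\<in>?V. F u w * H w v) =
        (\<Sum>(a, b)\<in>?V. (?p ^ i / ?p ^ k) ^ a * (?w ^ j / ?w ^ l) ^ b)"
    proof (rule sum.cong[OF refl])
      fix w assume "w \<in> ?V"
      obtain a b where w: "w = (a, b)" by (cases w)
      have swap: "(z ^ s) ^ t = (z ^ t) ^ s" for z :: complex and s t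
        by (simp add: mult.commute flip: power_mult)
      show "F u w * H w v = (case w of (a, b) \<Rightarrow> (?p ^ i / ?p ^ k) ^ a * (?w ^ j / ?w ^ l) ^ b)"
        unfolding F_def H_def uv w fst_conv snd_conv prod.case swap[of ?p a] swap[of ?w b] power_divide
        by (simp add: field_simps)
    qed
    also have "\<dots> = (\<Sum>a<m. (?p ^ i / ?p ^ k) ^ a) * (\<Sum>b<n. (?w ^ j / ?w ^ l) ^ b)"
      by (simp add: sum_product sum.cartesian_product)
    also have "\<dots> = (if u = v then of_nat (m * n) else 0)"
      using ij by (simp add: orth uv)
    finally show "(\<Sum>w\<in>?V. F u w * H w v) = (if u = v then of_nat (m * n) else 0)" .
  qed
  also have "\<dots> = (\<Prod>a<m. \<Prod>b<n. d (a, b))" by (simp add: prod.cartesian_product)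
  also have "\<dots> = (\<Prod>a<m. cycle_poly n (x + of_nat m * of_bool (a \<noteq> 0)))"
    unfolding cycle_poly_def d_def by simp
  also have "\<dots> = cycle_poly n x * cycle_poly n (x + of_nat m) ^ (m - 1)"
  proof -
    have "{..<m} = insert 0 {1..<m}" using m by auto
    then show ?thesis by simp
  qed
  finally show ?thesis unfolding uverts_prism .
qed

theorem corollary1p2:
  fixes m n :: nat
  assumes "m \<ge> 3" and "n \<ge> 3"
  shows "real (card (spanning_utrees (cartesian_ugraph (complete_ugraph m) (cycle_ugraph n)))) =
    real n / real m *
      (((real m + 2 + sqrt ((real m)\<^sup>2 + 4 * real m)) / 2) ^ n +
       ((real m + 2 - sqrt ((real m)\<^sup>2 + 4 * real m)) / 2) ^ n - 2) ^ (m - 1)"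
proof -
  let ?g = "\<lambda>x. cycle_poly_red n x * cycle_poly n (x + of_nat m) ^ (m - 1)"
  define s where "s = sqrt ((real m)\<^sup>2 + 4 * real m)"
  define \<alpha> where "\<alpha> = (real m + 2 + s) / 2"
  define \<beta> where "\<beta> = (real m + 2 - s) / 2"
  let ?t = "card (spanning_utrees (prism m n))"
  have n: "n > 0" and m: "m > 0" using assms by auto
  have "s\<^sup>2 = (real m)\<^sup>2 + 4 * real m" by (simp add: s_def)
  then have ab: "\<alpha> * \<beta> = 1"
    unfolding \<alpha>_def \<beta>_def by (simp add: field_simps power2_eq_square)
  have sum: "real m = \<alpha> + \<beta> - 2" unfolding \<alpha>_def \<beta>_def by (simp add: field_simps)
  have "of_real \<alpha> * of_real \<beta> = (1 :: complex)" using ab by (simp flip: of_real_mult)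
  moreover have "of_nat m = of_real \<alpha> + of_real \<beta> - (2 :: complex)"
    using arg_cong[OF sum, of complex_of_real] by simp
  ultimately have Q: "cycle_poly n (of_nat m) = of_real (\<alpha> ^ n + \<beta> ^ n - 2)"
    using cycle_poly_eq[OF n] by simp
  have "isCont ?g 0" by (intro continuous_intros)
  moreover have "simple_ugraph (prism m n)"
    by (intro simple_cartesian_ugraph simple_complete_ugraph simple_cycle_ugraph assms)
  moreover have "uverts (prism m n) \<noteq> {}" using n m by (auto simp: uverts_prism)
  moreover have "det_on (uverts (prism m n)) (\<lambda>u v. of_bool (u = v) *
      (x + of_nat (card (unbrs (prism m n) u))) - of_bool (v \<in> unbrs (prism m n) u)) = x * ?g x" for x
    unfolding det_Laplacian_prism[OF m assms(2)] cycle_poly_red[OF n, of x] by (rule mult.assoc)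
  ultimately have "of_nat (?t * card (uverts (prism m n))) = ?g 0"
    by (intro matrix_tree[where g = ?g])
  then have "complex_of_real (real ?t * (real m * real n)) =
      of_real ((real n)\<^sup>2 * (\<alpha> ^ n + \<beta> ^ n - 2) ^ (m - 1))"
    by (simp add: uverts_prism cycle_poly_red_0[OF n] Q)
  then have "real ?t * (real m * real n) = (real n)\<^sup>2 * (\<alpha> ^ n + \<beta> ^ n - 2) ^ (m - 1)"
    by (simp only: of_real_eq_iff)
  then have "real ?t = real n / real m * (\<alpha> ^ n + \<beta> ^ n - 2) ^ (m - 1)"
    using m n by (simp add: field_simps power2_eq_square)
  then show ?thesis unfolding \<alpha>_def \<beta>_def s_def .
qed

end
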